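(* Let $F$ be a continuous probability measure on $\mathbb{R}$ (i.e. without atoms), let $X,X_1,X_2,\ldots$ be i.i.d. with distribution $F$, let $n\ge2$ be an integer and $r>0$ a real number, and let $T_n$ be the $t$-statistic of $X_1,\ldots,X_n$. For $h\ge 0$ put $q(h)=\sup_{x\in\mathbb{R}}\mathrm{P}(|X-x|\le |x|h)$. Then: (i) if $q(h)=O(h^{\lambda})$ as $h\downarrow 0$ for some $\lambda>r/(n-1)$, then $\mathrm{E}|T_n|^r<\infty$; (ii) if $\mathrm{E}|T_n|^r<\infty$, then $q(h)=O(h^{\lambda})$ as $h\downarrow0$ with $\lambda=r/n$.
   Context: For $n\ge2$ set $S_n=\sum_{i=1}^n X_i$ and $\hat\sigma_n^2=\frac{1}{n-1}\sum_{i=1}^n (X_i-n^{-1}S_n)^2$, with $\hat\sigma_n\ge 0$. The $t$-statistic is $T_n=n^{-1/2}\hat\sigma_n^{-1}S_n$ if $\hat\sigma_n>0$ and $T_n=0$ if $\hat\sigma_n=0$. *)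

theory Defs
  imports "HOL-Probability.Probability"
begin

definition sample_sum :: "nat \<Rightarrow> (nat \<Rightarrow> real) \<Rightarrow> real" where
  "sample_sum n x = (\<Sum>i=1..n. x i)"

definition sample_sd :: "nat \<Rightarrow> (nat \<Rightarrow> real) \<Rightarrow> real" where
  "sample_sd n x = sqrt ((\<Sum>i=1..n. (x i - sample_sum n x / real n)\<^sup>2) / (real n - 1))"

definition t_stat :: "nat \<Rightarrow> (nat \<Rightarrow> real) \<Rightarrow> real" where
  "t_stat n x =
     (if sample_sd n x > 0 then sample_sum n x / (sqrt (real n) * sample_sd n x) else 0)"

text \<open>The paper's \<open>q(h)\<close>. The real-valued supremum is meaningful because probabilities are bounded by 1.\<close>

definition rel_conc :: "'a measure \<Rightarrow> ('a \<Rightarrow> real) \<Rightarrow> real \<Rightarrow> real" where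
  "rel_conc M X h = (SUP x. measure M {\<omega> \<in> space M. \<bar>X \<omega> - x\<bar> \<le> \<bar>x\<bar> * h})"

end

theory Submission imports Defs begin

text \<open>
  If \<open>\<bar>T\<^sub>n\<bar> > t\<close> with \<open>t\<close> large, the sample standard deviation is small compared to the mean, so
  all \<open>X\<^sub>i\<close> lie within relative distance \<open>4n/t\<close> of \<open>X\<^sub>1\<close>; conditioning on \<open>X\<^sub>1\<close> gives
  \<open>P(\<bar>T\<^sub>n\<bar> > t) \<le> q(4n/t)\<^bsup>n-1\<^esup>\<close>, hence (i). Conversely, if all \<open>n\<close> observations lie within
  relative distance \<open>h \<le> 1/2\<close> of some \<open>x \<noteq> 0\<close>, then \<open>\<bar>T\<^sub>n\<bar> \<ge> 1/(2h)\<close> unless the sample is constant,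
  which is a null event for continuous \<open>F\<close>; Markov's inequality then bounds
  \<open>P(\<bar>X - x\<bar> \<le> \<bar>x\<bar>h)\<^bsup>n\<^esup>\<close> by a multiple of \<open>h\<^bsup>r\<^esup>\<close>, hence (ii).
\<close>

section \<open>Deterministic inequalities between the t-statistic and relative spread\<close>

text \<open>One squared deviation is at most their sum, which is \<open>n - 1\<close> times the
  sample variance. Enlarging \<open>n - 1\<close> to \<open>n\<close> makes the bound exactly the
  denominator of \<open>t_stat\<close>.\<close>

lemma abs_diff_mean_le_sample_sd:
  assumes "n \<ge> 2" "i \<in> {1..n}"
  shows "\<bar>x i - sample_sum n x / real n\<bar> \<le> sqrt (real n) * sample_sd n x"
proof -
  define m where "m = sample_sum n x / real n"
  define V where "V = (\<Sum>j=1..n. (x j - m)\<^sup>2)"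
  have V: "(x i - m)\<^sup>2 \<le> V"
    unfolding V_def using assms(2) by (intro member_le_sum) auto
  have "V \<ge> 0" unfolding V_def by (intro sum_nonneg) auto
  moreover have "1 \<le> real n / (real n - 1)"
    using assms(1) by (simp add: field_simps)
  ultimately have "V * 1 \<le> V * (real n / (real n - 1))"
    by (intro mult_left_mono)
  with V have "(x i - m)\<^sup>2 \<le> real n * (V / (real n - 1))"
    by (simp add: mult.commute)
  then have "sqrt ((x i - m)\<^sup>2) \<le> sqrt (real n * (V / (real n - 1)))"
    by (rule real_sqrt_le_mono)
  then show ?thesis
    by (simp only: real_sqrt_abs real_sqrt_mult sample_sd_def m_def V_def)
qed

text \<open>Solved for its denominator, the hypothesis on \<open>t_stat\<close> puts every
  observation within \<open>n/t * |m|\<close> of the mean \<open>m\<close>. Since \<open>t\<close>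
  is at least \<open>4n\<close>, this radius is at most \<open>|m|/4\<close>, so \<open>|m|\<close>
  is at most \<open>2 * |x 1|\<close>. The triangle inequality through \<open>m\<close> costs
  another factor 2, whence the 4.\<close>

lemma rel_close_if_t_stat_large:
  assumes n: "n \<ge> 2" and t: "t \<ge> 4 * real n" and T: "\<bar>t_stat n x\<bar> > t" and i: "i \<in> {1..n}"
  shows "\<bar>x i - x 1\<bar> \<le> \<bar>x 1\<bar> * (4 * real n / t)"
proof -
  define m where "m = sample_sum n x / real n"
  define s where "s = sample_sd n x"
  have n0: "real n > 0" and t0: "t > 0" using n t by auto
  \<comment> \<open>A vanishing deviation would give the default value 0 of \<open>t_stat\<close>,
    contradicting \<open>|T| > t > 0\<close>.\<close>
  have s0: "s > 0"
    using T t0 unfolding t_stat_def s_def by (auto split: if_splits)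
  have "t * (sqrt (real n) * s) < \<bar>sample_sum n x\<bar>"
    using T s0 n0 unfolding t_stat_def s_def[symmetric]
    by (simp add: abs_mult pos_less_divide_eq)
  also have "\<bar>sample_sum n x\<bar> = real n * \<bar>m\<bar>"
    using n0 by (simp add: m_def abs_mult)
  finally have "sqrt (real n) * s \<le> real n / t * \<bar>m\<bar>"
    using t0 by (simp add: field_simps)
  then have d: "\<bar>x j - m\<bar> \<le> real n / t * \<bar>m\<bar>" if "j \<in> {1..n}" for j
    using abs_diff_mean_le_sample_sd[OF n that, of x] by (simp add: m_def s_def)
  have q: "real n / t * \<bar>m\<bar> \<le> 1/4 * \<bar>m\<bar>"
    using t t0 by (intro mult_right_mono) (auto simp: field_simps)
  have x1: "\<bar>m\<bar> \<le> 2 * \<bar>x 1\<bar>"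
  proof -
    have "1 \<in> {1..n}" using n by simp
    from d[OF this] q show ?thesis by linarith
  qed
  have "\<bar>x i - x 1\<bar> \<le> 2 * (real n / t * \<bar>m\<bar>)"
    using d[of 1] d[OF i] n by (auto simp del: One_nat_def)
  also have "\<dots> \<le> 2 * (real n / t * (2 * \<bar>x 1\<bar>))"
    using x1 n0 t0 by (intro mult_left_mono) auto
  finally show ?thesis by (simp add: mult_ac)
qed

text \<open>Steiner's identity: the sum of squares about \<open>a\<close> exceeds that about the
  mean \<open>m\<close> by \<open>n * (m - a)^2\<close>.\<close>

lemma sum_sq_diff_mean_le:
  assumes "n \<ge> 1"
  shows "(\<Sum>i=1..n. (x i - sample_sum n x / real n)\<^sup>2) \<le> (\<Sum>i=1..n. (x i - a)\<^sup>2)"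
proof -
  define m where "m = sample_sum n x / real n"
  have S: "(\<Sum>i=1..n. x i) = real n * m"
    using assms by (simp add: m_def sample_sum_def)
  have "(\<Sum>i=1..n. (x i - a)\<^sup>2)
      = (\<Sum>i=1..n. (x i - m)\<^sup>2 + 2 * (m - a) * x i + (a\<^sup>2 - m\<^sup>2))"
    by (intro sum.cong) (auto simp: power2_eq_square algebra_simps)
  also have "\<dots> = (\<Sum>i=1..n. (x i - m)\<^sup>2) + 2 * (m - a) * (\<Sum>i=1..n. x i) + real n * (a\<^sup>2 - m\<^sup>2)"
    by (simp add: sum.distrib sum_distrib_left)
  also have "\<dots> = (\<Sum>i=1..n. (x i - m)\<^sup>2) + real n * (m - a)\<^sup>2"
    unfolding S by (simp add: power2_eq_square algebra_simps)
  finally show ?thesis by (simp add: m_def)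
qed

text \<open>The denominator of \<open>t_stat\<close> is at most \<open>n * |a| * h\<close>, by
  comparing the variance with the mean square about \<open>a\<close>; the numerator is at least
  \<open>n * |a| / 2\<close>, because \<open>h\<close> is at most 1/2. Positivity of
  \<open>sample_sd\<close> excludes constant samples, where \<open>t_stat\<close> is 0 by
  convention.\<close>

lemma t_stat_large_if_rel_close:
  assumes n: "n \<ge> 2" and h: "0 < h" "h \<le> 1/2" and a: "a \<noteq> 0"
    and close: "\<And>i. i \<in> {1..n} \<Longrightarrow> \<bar>x i - a\<bar> \<le> \<bar>a\<bar> * h"
    and sd: "sample_sd n x > 0"
  shows "\<bar>t_stat n x\<bar> \<ge> 1 / (2 * h)"
proof -
  have n0: "real n - 1 \<ge> 1" using n by simp
  have "(\<Sum>i=1..n. (x i - sample_sum n x / real n)\<^sup>2) \<le> (\<Sum>i=1..n. (x i - a)\<^sup>2)"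
    using n by (intro sum_sq_diff_mean_le) auto
  also have "\<dots> \<le> (\<Sum>i=1..n. (\<bar>a\<bar> * h)\<^sup>2)"
    using close by (intro sum_mono abs_le_square_iff[THEN iffD1]) (use h in \<open>auto simp: abs_mult\<close>)
  also have "\<dots> = real n * (\<bar>a\<bar> * h)\<^sup>2" by simp
  finally have V: "(\<Sum>i=1..n. (x i - sample_sum n x / real n)\<^sup>2) \<le> real n * (\<bar>a\<bar> * h)\<^sup>2" .
  have "(\<Sum>i=1..n. (x i - sample_sum n x / real n)\<^sup>2) / (real n - 1)
      \<le> (\<Sum>i=1..n. (x i - sample_sum n x / real n)\<^sup>2) / 1"
    using n0 by (intro divide_left_mono sum_nonneg) auto
  with V have "sample_sd n x \<le> sqrt (real n * (\<bar>a\<bar> * h)\<^sup>2)"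
    unfolding sample_sd_def by (intro real_sqrt_le_mono) simp
  then have "sample_sd n x \<le> sqrt (real n) * (\<bar>a\<bar> * h)"
    using h by (simp add: real_sqrt_mult)
  then have "sqrt (real n) * sample_sd n x \<le> sqrt (real n) * (sqrt (real n) * (\<bar>a\<bar> * h))"
    by (intro mult_left_mono) auto
  then have D: "sqrt (real n) * sample_sd n x \<le> real n * (\<bar>a\<bar> * h)"
    by (simp only: mult.assoc[symmetric] real_sqrt_mult_self abs_of_nat)
  have "\<bar>sample_sum n x - real n * a\<bar> = \<bar>\<Sum>i=1..n. (x i - a)\<bar>"
    by (simp add: sample_sum_def sum_subtractf)
  also have "\<dots> \<le> (\<Sum>i=1..n. \<bar>x i - a\<bar>)" by (rule sum_abs)
  also have "\<dots> \<le> (\<Sum>i=1..n. \<bar>a\<bar> * h)" using close by (intro sum_mono)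
  also have "\<dots> = real n * \<bar>a\<bar> * h" by simp
  also have "\<dots> \<le> real n * \<bar>a\<bar> * (1/2)" using h by (intro mult_left_mono) auto
  finally have "real n * \<bar>a\<bar> / 2 \<le> \<bar>sample_sum n x\<bar>"
    using abs_triangle_ineq2_sym[of "real n * a" "sample_sum n x"] by (simp add: abs_mult)
  then have "1 / (2 * h) * (real n * (\<bar>a\<bar> * h)) \<le> \<bar>sample_sum n x\<bar>"
    using h by simp
  moreover have "1 / (2 * h) * (sqrt (real n) * sample_sd n x) \<le> 1 / (2 * h) * (real n * (\<bar>a\<bar> * h))"
    using D h by (intro mult_left_mono) auto
  ultimately have "1 / (2 * h) * (sqrt (real n) * sample_sd n x) \<le> \<bar>sample_sum n x\<bar>"
    by linarith
  then have "1 / (2 * h) \<le> \<bar>sample_sum n x\<bar> / (sqrt (real n) * sample_sd n x)"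
    using sd n by (subst pos_le_divide_eq) auto
  then show ?thesis using sd by (simp add: t_stat_def abs_mult)
qed

section \<open>Moments from tail bounds\<close>

text \<open>Dyadic decomposition: where \<open>|T|\<close> lies between \<open>t k\<close> and
  \<open>t (Suc k) = 2 * t k\<close>, the integrand is at most \<open>t (Suc k) powr r\<close>,
  while \<open>|T| > t k\<close> has probability at most \<open>C * t k powr (-s)\<close>. The
  products form a geometric series of ratio \<open>2 powr (r - s) < 1\<close>.\<close>

lemma nn_integral_powr_finite_if_tail:
  fixes T :: "'a \<Rightarrow> real"
  assumes "prob_space M" and T[measurable]: "T \<in> borel_measurable M"
    and r: "0 < r" "r < s"
    and tail: "\<And>t. t \<ge> t0 \<Longrightarrow> measure M {\<omega> \<in> space M. \<bar>T \<omega>\<bar> > t} \<le> C * t powr (- s)"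
  shows "(\<integral>\<^sup>+ \<omega>. ennreal (\<bar>T \<omega>\<bar> powr r) \<partial>M) < \<infinity>"
proof -
  interpret prob_space M by fact
  obtain k0 where "t0 < real k0" using reals_Archimedean2 by blast
  moreover have "real k0 < 2 ^ k0" by (rule of_nat_less_two_power)
  ultimately have k0: "t0 \<le> 2 ^ k0" by linarith
  define t where "t k = (2::real) ^ (k0 + k)" for k
  have t1: "t k \<ge> t0" "t k > 0" for k
    using k0 power_increasing[of k0 "k0 + k" "2::real"] unfolding t_def by (auto intro: order_trans)
  define q where "q = (2::real) powr (r - s)"
  have q: "0 < q" "q < 1" using r by (auto simp: q_def powr_less_one)
  define E where "E k = {\<omega> \<in> space M. \<bar>T \<omega>\<bar> > t k}" for k
  have [measurable]: "E k \<in> sets M" for k unfolding E_def by measurable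
  have t2: "t (Suc k) = 2 * t k" for k by (simp add: t_def)
  have point: "ennreal (\<bar>T \<omega>\<bar> powr r)
      \<le> ennreal (t 0 powr r) + (\<Sum>k. ennreal (t (Suc k) powr r) * indicator (E k) \<omega>)"
    if \<omega>: "\<omega> \<in> space M" for \<omega>
  proof (cases "\<bar>T \<omega>\<bar> \<le> t 0")
    case True
    then have "ennreal (\<bar>T \<omega>\<bar> powr r) \<le> ennreal (t 0 powr r)"
      using r by (intro ennreal_leI powr_mono2) auto
    then show ?thesis by (rule order_trans) simp
  next
    case False
    have ex: "\<exists>k. \<bar>T \<omega>\<bar> \<le> t k"
    proof -
      obtain k where "\<bar>T \<omega>\<bar> < real k" using reals_Archimedean2 by blast
      moreover have "real k < 2 ^ k" by (rule of_nat_less_two_power)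
      moreover have "(2::real) ^ k \<le> t k" unfolding t_def by (intro power_increasing) auto
      ultimately have "\<bar>T \<omega>\<bar> \<le> t k" by linarith
      then show ?thesis ..
    qed
    \<comment> \<open>The first level reaching \<open>|T \<omega>|\<close> is not level 0, so it has
      a predecessor \<open>k\<close>; then \<omega> lies in \<open>E k\<close>, and the single term
      \<open>k\<close> of the series already dominates.\<close>
    define l where "l = (LEAST k. \<bar>T \<omega>\<bar> \<le> t k)"
    have l: "\<bar>T \<omega>\<bar> \<le> t l" unfolding l_def using ex by (rule LeastI_ex)
    then obtain k where k: "l = Suc k" using False by (cases l) auto
    have "\<not> \<bar>T \<omega>\<bar> \<le> t k"
      using not_less_Least[of k "\<lambda>k. \<bar>T \<omega>\<bar> \<le> t k"] k by (auto simp: l_def)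
    then have "\<omega> \<in> E k" using \<omega> by (simp add: E_def)
    define g where "g k = ennreal (t (Suc k) powr r) * indicator (E k) \<omega>" for k
    have "ennreal (\<bar>T \<omega>\<bar> powr r) \<le> g k"
      using l r \<open>\<omega> \<in> E k\<close> by (auto simp: k g_def intro!: ennreal_leI powr_mono2)
    also have "\<dots> \<le> (\<Sum>k. g k)"
      using sum_le_suminf[of g "{k}"] by simp
    finally show ?thesis unfolding g_def by (rule order_trans) simp
  qed
  have term_le: "ennreal (t (Suc k) powr r) * emeasure M (E k)
      \<le> ennreal (2 powr r * C * t 0 powr (r - s) * q ^ k)" for k
  proof -
    have "t (Suc k) powr r * measure M (E k) \<le> t (Suc k) powr r * (C * t k powr (- s))"
      unfolding E_def using tail[OF t1(1)] by (intro mult_left_mono) auto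
    also have "\<dots> = 2 powr r * C * t k powr (r - s)"
      using t1(2)[of k] by (simp add: t2 powr_mult powr_diff powr_minus field_simps)
    also have "t k = t 0 * 2 ^ k" by (simp add: t_def power_add)
    also have "(t 0 * 2 ^ k) powr (r - s) = t 0 powr (r - s) * q ^ k"
      using t1(2)[of 0] by (simp add: powr_mult q_def powr_powr powr_realpow[symmetric] mult.commute)
    finally show ?thesis
      by (simp add: emeasure_eq_measure ennreal_mult'[symmetric] ennreal_leI mult_ac)
  qed
  have "(\<integral>\<^sup>+ \<omega>. ennreal (\<bar>T \<omega>\<bar> powr r) \<partial>M)
     \<le> (\<integral>\<^sup>+ \<omega>. ennreal (t 0 powr r) + (\<Sum>k. ennreal (t (Suc k) powr r) * indicator (E k) \<omega>) \<partial>M)"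
    by (intro nn_integral_mono point)
  also have "\<dots> = ennreal (t 0 powr r) + (\<Sum>k. ennreal (t (Suc k) powr r) * emeasure M (E k))"
    by (simp add: nn_integral_add nn_integral_suminf nn_integral_cmult emeasure_space_1)
  also have "\<dots> \<le> ennreal (t 0 powr r) + (\<Sum>k. ennreal (2 powr r * C * t 0 powr (r - s) * q ^ k))"
    by (intro add_left_mono suminf_le term_le) auto
  also have "\<dots> < \<infinity>"
  proof -
    \<comment> \<open>The sign of \<open>C\<close> is not assumed; it follows from the tail bound at
      \<open>t 0\<close>, whose left side is nonnegative.\<close>
    have "0 \<le> measure M {\<omega> \<in> space M. \<bar>T \<omega>\<bar> > t 0}" by simp
    also have "\<dots> \<le> C * t 0 powr (- s)" using t1 by (intro tail)
    finally have "0 \<le> C" using t1(2)[of 0] by (simp add: zero_le_mult_iff)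
    moreover have "summable (\<lambda>k. 2 powr r * C * t 0 powr (r - s) * q ^ k)"
      using q by (intro summable_mult summable_geometric) auto
    ultimately have "(\<Sum>k. ennreal (2 powr r * C * t 0 powr (r - s) * q ^ k)) < \<top>"
      using q by (subst suminf_ennreal2) auto
    then show ?thesis by (simp add: ennreal_add_eq_top less_top[symmetric])
  qed
  finally show ?thesis .
qed

section \<open>The concentration function and independent samples\<close>

lemma rel_conc_bdd_above:
  assumes "prob_space M"
  shows "bdd_above (range (\<lambda>x. measure M {\<omega> \<in> space M. \<bar>X \<omega> - x\<bar> \<le> \<bar>x\<bar> * h}))"
  using prob_space.prob_le_1[OF assms] by (auto intro!: bdd_aboveI[where M = 1])

lemma measure_le_rel_conc:
  assumes "prob_space M"
  shows "measure M {\<omega> \<in> space M. \<bar>X \<omega> - x\<bar> \<le> \<bar>x\<bar> * h} \<le> rel_conc M X h"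
  unfolding rel_conc_def by (intro cSUP_upper rel_conc_bdd_above assms) auto

lemma rel_conc_nonneg:
  assumes "prob_space M"
  shows "rel_conc M X h \<ge> 0"
  using measure_le_rel_conc[OF assms, of X 0 h] measure_nonneg order_trans by blast

text \<open>The centre is itself random, so Fubini is used: with the first coordinate frozen at
  \<open>y\<close>, the other \<open>n - 1\<close> coordinates are independent, and each falls in
  the window around \<open>y\<close> with probability at most \<open>rel_conc M X h\<close>,
  uniformly in \<open>y\<close>.\<close>

lemma prob_close_to_first_le:
  assumes "prob_space M" and F: "prob_space F" "sets F = sets borel"
    and X: "X \<in> borel_measurable M" "distr M borel X = F"
    and ind: "prob_space.indep_vars M (\<lambda>_. borel) Xs {1..}"
    and id: "\<And>i::nat. i \<ge> 1 \<Longrightarrow> distr M borel (Xs i) = F"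
    and n: "n \<ge> 2"
  shows "measure M {\<omega> \<in> space M. \<forall>i\<in>{2..n}. \<bar>Xs i \<omega> - Xs 1 \<omega>\<bar> \<le> \<bar>Xs 1 \<omega>\<bar> * h}
    \<le> rel_conc M X h ^ (n - 1)"
proof -
  interpret prob_space M by fact
  interpret F: prob_space F by fact
  interpret P: product_prob_space "\<lambda>_::nat. F" UNIV by unfold_locales
  note F(2)[measurable_cong]
  have XsM[measurable]: "Xs i \<in> borel_measurable M" if "i \<ge> 1" for i
    using ind that by (auto simp: indep_vars_def)
  have "indep_vars (\<lambda>_. borel) Xs {1..n}"
    using ind by (rule indep_vars_subset) auto
  then have "distr M (Pi\<^sub>M {1..n} (\<lambda>_. borel)) (\<lambda>\<omega>. \<lambda>i\<in>{1..n}. Xs i \<omega>)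
      = Pi\<^sub>M {1..n} (\<lambda>i. distr M borel (Xs i))"
    using n by (subst (asm) indep_vars_iff_distr_eq_PiM') auto
  also have "\<dots> = Pi\<^sub>M {1..n} (\<lambda>_. F)" using id by (intro PiM_cong) auto
  finally have dist: "distr M (Pi\<^sub>M {1..n} (\<lambda>_. borel)) (\<lambda>\<omega>. \<lambda>i\<in>{1..n}. Xs i \<omega>) = Pi\<^sub>M {1..n} (\<lambda>_. F)" .

  define K where "K y = {z::real. \<bar>z - y\<bar> \<le> \<bar>y\<bar> * h}" for y
  \<comment> \<open>The indicator of the event is written as a product over coordinates so that the
    inner integral factorizes; the form \<open>f_alt\<close> serves for measurability.\<close>
  define f :: "(nat \<Rightarrow> real) \<Rightarrow> ennreal"
    where "f x = (\<Prod>i\<in>{2..n}. indicator (K (x 1)) (x i))" for x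
  have f_alt: "f x = (if \<forall>i\<in>{2..n}. \<bar>x i - x 1\<bar> \<le> \<bar>x 1\<bar> * h then 1 else 0)" for x
    by (auto simp: f_def K_def indicator_def intro!: prod_zero)
  have set1n: "{1..n} = insert 1 {2..n}" using n by auto
  have fM: "f \<in> borel_measurable (Pi\<^sub>M {1..n} (\<lambda>_. borel))"
  proof -
    have "Measurable.pred (Pi\<^sub>M {1..n} (\<lambda>_. borel)) (\<lambda>x::nat\<Rightarrow>real. \<forall>i\<in>{2..n}. \<bar>x i - x 1\<bar> \<le> \<bar>x 1\<bar> * h)"
    proof (intro pred_intros_finite)
      fix i assume "i \<in> {2..n}"
      then have "i \<in> {1..n}" "1 \<in> {1..n}" by auto
      note m = this[THEN measurable_component_singleton, where M = "\<lambda>_. borel :: real measure"]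
      show "Measurable.pred (Pi\<^sub>M {1..n} (\<lambda>_. borel)) (\<lambda>x::nat\<Rightarrow>real. \<bar>x i - x 1\<bar> \<le> \<bar>x 1\<bar> * h)"
        unfolding pred_def
        by (intro borel_measurable_le borel_measurable_abs borel_measurable_diff
            borel_measurable_times borel_measurable_const m)
    qed auto
    then show ?thesis unfolding f_alt[abs_def] by measurable
  qed
  have rM[measurable]: "(\<lambda>\<omega>. \<lambda>i\<in>{1..n}. Xs i \<omega>) \<in> M \<rightarrow>\<^sub>M Pi\<^sub>M {1..n} (\<lambda>_. borel)"
    by (intro measurable_restrict XsM) auto
  let ?A = "{\<omega> \<in> space M. \<forall>i\<in>{2..n}. \<bar>Xs i \<omega> - Xs 1 \<omega>\<bar> \<le> \<bar>Xs 1 \<omega>\<bar> * h}"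
  have A_eq: "indicator ?A \<omega> = f (\<lambda>i\<in>{1..n}. Xs i \<omega>)" if "\<omega> \<in> space M" for \<omega>
    using that n unfolding f_alt by (auto simp: indicator_def)
  have A: "?A \<in> sets M"
  proof -
    have "?A = {\<omega> \<in> space M. f (\<lambda>i\<in>{1..n}. Xs i \<omega>) = 1}"
      using n unfolding f_alt by auto
    also have "\<dots> \<in> sets M" using measurable_compose[OF rM fM] by measurable
    finally show ?thesis .
  qed
  have Kq: "emeasure F (K y) \<le> ennreal (rel_conc M X h)" for y
  proof -
    have "K y \<in> sets borel" unfolding K_def by measurable
    then have "emeasure F (K y) = emeasure M (X -` K y \<inter> space M)"
      unfolding X(2)[symmetric] using X(1) by (simp add: emeasure_distr)
    also have "X -` K y \<inter> space M = {\<omega> \<in> space M. \<bar>X \<omega> - y\<bar> \<le> \<bar>y\<bar> * h}"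
      by (auto simp: K_def)
    also have "emeasure M \<dots> \<le> ennreal (rel_conc M X h)"
      unfolding emeasure_eq_measure
      by (intro ennreal_leI measure_le_rel_conc prob_space_axioms)
    finally show ?thesis .
  qed
  have "emeasure M ?A = (\<integral>\<^sup>+ \<omega>. indicator ?A \<omega> \<partial>M)" using A by simp
  also have "\<dots> = (\<integral>\<^sup>+ \<omega>. f (\<lambda>i\<in>{1..n}. Xs i \<omega>) \<partial>M)"
    by (intro nn_integral_cong A_eq)
  also have "\<dots> = (\<integral>\<^sup>+ x. f x \<partial>Pi\<^sub>M {1..n} (\<lambda>_. F))"
    unfolding dist[symmetric] by (rule nn_integral_distr[OF rM, symmetric]) (simp only: fM measurable_distr_eq1)
  \<comment> \<open>Fubini with coordinate 1 outermost.\<close>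
  also have "\<dots> = (\<integral>\<^sup>+ y. (\<integral>\<^sup>+ x. f (x(1 := y)) \<partial>Pi\<^sub>M {2..n} (\<lambda>_. F)) \<partial>F)"
  proof -
    have "f \<in> borel_measurable (Pi\<^sub>M {1..n} (\<lambda>_. F))"
      using fM
      by (simp add: measurable_cong_sets[OF sets_PiM_cong[OF refl F(2)] refl])
    then show ?thesis
      unfolding set1n by (intro P.product_nn_integral_insert_rev) auto
  qed
  also have "\<dots> = (\<integral>\<^sup>+ y. (\<integral>\<^sup>+ x. (\<Prod>i\<in>{2..n}. indicator (K y) (x i)) \<partial>Pi\<^sub>M {2..n} (\<lambda>_. F)) \<partial>F)"
    by (intro nn_integral_cong) (auto simp: f_def intro!: prod.cong)
  also have "\<dots> = (\<integral>\<^sup>+ y. (\<Prod>i\<in>{2..n}. emeasure F (K y)) \<partial>F)"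
    by (intro nn_integral_cong, subst P.product_nn_integral_prod)
       (auto simp: K_def F(2))
  also have "\<dots> \<le> (\<integral>\<^sup>+ y. ennreal (rel_conc M X h) ^ (n - 1) \<partial>F)"
    by (intro nn_integral_mono) (use Kq in \<open>auto intro!: power_mono simp: Suc_diff_le\<close>)
  also have "\<dots> = ennreal (rel_conc M X h ^ (n - 1))"
    by (simp add: F.emeasure_space_1 ennreal_power rel_conc_nonneg prob_space_axioms)
  finally show ?thesis
    by (simp add: emeasure_eq_measure rel_conc_nonneg prob_space_axioms)
qed

text \<open>Here the centre is fixed, so all \<open>n\<close> observations contribute a factor. The
  exponent \<open>n\<close>, against \<open>n - 1\<close> for the random centre, is the source of
  the gap between \<open>r / n\<close> and \<open>r / (n - 1)\<close> in the two
  implications.\<close>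

lemma prob_all_close_eq:
  assumes "prob_space M"
    and X: "X \<in> borel_measurable M" "distr M borel X = (F :: real measure)"
    and ind: "prob_space.indep_vars M (\<lambda>_. borel) Xs {1..}"
    and id: "\<And>i::nat. i \<ge> 1 \<Longrightarrow> distr M borel (Xs i) = F"
    and n: "n \<ge> 1"
  shows "measure M {\<omega> \<in> space M. \<forall>i\<in>{1..n}. \<bar>Xs i \<omega> - x\<bar> \<le> \<bar>x\<bar> * h}
    = measure M {\<omega> \<in> space M. \<bar>X \<omega> - x\<bar> \<le> \<bar>x\<bar> * h} ^ n"
proof -
  interpret prob_space M by fact
  define K where "K = {z::real. \<bar>z - x\<bar> \<le> \<bar>x\<bar> * h}"
  have K[measurable]: "K \<in> sets borel" unfolding K_def by measurable
  have F: "measure F K = prob (Y -` K \<inter> space M)"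
    if "Y \<in> borel_measurable M" "distr M borel Y = F" for Y
    using measure_distr[OF that(1) K] that(2) by simp
  have Xs: "prob (Xs i -` K \<inter> space M) = measure F K" if "i \<in> {1..n}" for i
    using ind that id by (subst F) (auto simp: indep_vars_def)
  have "{\<omega> \<in> space M. \<forall>i\<in>{1..n}. \<bar>Xs i \<omega> - x\<bar> \<le> \<bar>x\<bar> * h} = (\<Inter>i\<in>{1..n}. Xs i -` K \<inter> space M)"
    using n by (auto simp: K_def)
  also have "prob \<dots> = (\<Prod>i\<in>{1..n}. prob (Xs i -` K \<inter> space M))"
    using n by (intro indep_varsD[OF ind]) auto
  also have "\<dots> = measure F K ^ n" by (simp add: Xs)
  also have "measure F K = prob {\<omega> \<in> space M. \<bar>X \<omega> - x\<bar> \<le> \<bar>x\<bar> * h}"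
    unfolding F[OF X] by (rule arg_cong[where f = prob]) (auto simp: K_def)
  finally show ?thesis .
qed

lemma borel_measurable_t_stat:
  assumes "\<And>i. i \<in> {1..n} \<Longrightarrow> Xs i \<in> borel_measurable M"
  shows "(\<lambda>\<omega>. t_stat n (\<lambda>i. Xs i \<omega>)) \<in> borel_measurable M"
    and "(\<lambda>\<omega>. sample_sd n (\<lambda>i. Xs i \<omega>)) \<in> borel_measurable M"
proof -
  have S[measurable]: "(\<lambda>\<omega>. sample_sum n (\<lambda>i. Xs i \<omega>)) \<in> borel_measurable M"
    unfolding sample_sum_def using assms by (intro borel_measurable_sum)
  show [measurable]: "(\<lambda>\<omega>. sample_sd n (\<lambda>i. Xs i \<omega>)) \<in> borel_measurable M"
    unfolding sample_sd_def using assms S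
    by (intro measurable_compose[OF _ borel_measurable_sqrt] borel_measurable_divide
        borel_measurable_sum borel_measurable_power borel_measurable_diff borel_measurable_const)
  show "(\<lambda>\<omega>. t_stat n (\<lambda>i. Xs i \<omega>)) \<in> borel_measurable M"
    unfolding t_stat_def by measurable
qed

section \<open>Concentration and moments of the t-statistic\<close>

theorem theorem5p1:
  fixes F :: "real measure" and M :: "'a measure"
    and X :: "'a \<Rightarrow> real" and Xs :: "nat \<Rightarrow> 'a \<Rightarrow> real"
    and n :: nat and r :: real
  assumes "real_distribution F"
    and "\<And>x. measure F {x} = 0"
    and "prob_space M"
    and "X \<in> borel_measurable M" and "distr M borel X = F"
    and "prob_space.indep_vars M (\<lambda>_. borel) Xs {1..}"
    and "\<And>i. i \<ge> 1 \<Longrightarrow> distr M borel (Xs i) = F"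
    and "n \<ge> 2" and "r > 0"
  shows
    "((\<exists>c::real. c > r / (real n - 1) \<and> rel_conc M X \<in> O[at_right 0](\<lambda>h. h powr c))
        \<longrightarrow> (\<integral>\<^sup>+ \<omega>. ennreal (\<bar>t_stat n (\<lambda>i. Xs i \<omega>)\<bar> powr r) \<partial>M) < \<infinity>)
     \<and> ((\<integral>\<^sup>+ \<omega>. ennreal (\<bar>t_stat n (\<lambda>i. Xs i \<omega>)\<bar> powr r) \<partial>M) < \<infinity>
        \<longrightarrow> rel_conc M X \<in> O[at_right 0](\<lambda>h. h powr (r / real n)))"
proof -
  interpret prob_space M by fact
  interpret F: real_distribution F by fact
  note n = \<open>n \<ge> 2\<close> and r = \<open>r > 0\<close>
  let ?q = "rel_conc M X"
  let ?T = "\<lambda>\<omega>. t_stat n (\<lambda>i. Xs i \<omega>)"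
  let ?p = "\<lambda>x h. prob {\<omega> \<in> space M. \<bar>X \<omega> - x\<bar> \<le> \<bar>x\<bar> * h}"
  have q0: "?q h \<ge> 0" for h by (rule rel_conc_nonneg) fact
  have XsM: "Xs i \<in> borel_measurable M" if "i \<in> {1..n}" for i
    using assms(6) that by (auto simp: indep_vars_def)
  note [measurable] = borel_measurable_t_stat(1)[OF XsM]
  note close = prob_close_to_first_le[OF assms(3) F.prob_space_axioms F.events_eq_borel
      assms(4,5,6,7) n]
  have closeM: "{\<omega> \<in> space M. \<forall>i\<in>{2..n}. \<bar>Xs i \<omega> - Xs 1 \<omega>\<bar> \<le> \<bar>Xs 1 \<omega>\<bar> * h} \<in> events" for h
  proof -
    have [measurable]: "Xs 1 \<in> borel_measurable M" using n by (intro XsM) auto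
    have [measurable]: "Xs i \<in> borel_measurable M" if "i \<in> {2..n}" for i
      using that by (intro XsM) auto
    show ?thesis by measurable
  qed
  have pX0: "prob {\<omega> \<in> space M. \<bar>X \<omega> - x\<bar> \<le> 0} = 0" for x
  proof -
    have "{\<omega> \<in> space M. \<bar>X \<omega> - x\<bar> \<le> 0} = X -` {x} \<inter> space M" by auto
    with measure_distr[OF assms(4), of "{x}"] assms(2)[of x] assms(5) show ?thesis by simp
  qed
  \<comment> \<open>For \<open>h = 0\<close> the event in \<open>close\<close> says that the sample
    is constant. Absence of atoms gives \<open>?q 0 = 0\<close>, and since \<open>n - 1\<close> is
    at least 1 the event is null.\<close>
  then have "?q 0 = 0" by (simp add: rel_conc_def)
  with close[of 0] n have "prob {\<omega> \<in> space M. \<forall>i\<in>{2..n}. \<bar>Xs i \<omega> - Xs 1 \<omega>\<bar> \<le> \<bar>Xs 1 \<omega>\<bar> * 0} = 0"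
    using measure_nonneg[of M] by (simp add: zero_power order_antisym)
  then have "AE \<omega> in M. \<omega> \<notin> {\<omega> \<in> space M. \<forall>i\<in>{2..n}. \<bar>Xs i \<omega> - Xs 1 \<omega>\<bar> \<le> \<bar>Xs 1 \<omega>\<bar> * 0}"
    using closeM[of 0] prob_eq_0 by blast
  then have sd: "AE \<omega> in M. sample_sd n (\<lambda>i. Xs i \<omega>) > 0"
  proof (rule AE_mp, intro AE_I2 impI)
    fix \<omega> assume \<omega>: "\<omega> \<in> space M"
      "\<omega> \<notin> {\<omega> \<in> space M. \<forall>i\<in>{2..n}. \<bar>Xs i \<omega> - Xs 1 \<omega>\<bar> \<le> \<bar>Xs 1 \<omega>\<bar> * 0}"
    then obtain i where i: "i \<in> {2..n}" "Xs i \<omega> \<noteq> Xs 1 \<omega>" by auto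
    let ?x = "\<lambda>i. Xs i \<omega>" and ?m = "sample_sum n (\<lambda>i. Xs i \<omega>) / real n"
    show "sample_sd n ?x > 0"
    proof (rule ccontr)
      assume "\<not> ?thesis"
      \<comment> \<open>Zero deviation forces every observation to equal the mean, contradicting
        \<open>Xs i \<omega> \<noteq> Xs 1 \<omega>\<close>.\<close>
      then have "sqrt (real n) * sample_sd n ?x \<le> 0" by (simp add: mult_nonneg_nonpos)
      then have "\<bar>?x j - ?m\<bar> \<le> 0" if "j \<in> {1..n}" for j
        using abs_diff_mean_le_sample_sd[OF n that, of ?x] by linarith
      from this[of i] this[of 1] i n show False by auto
    qed
  qed

  \<comment> \<open>Finite moment from the concentration bound\<close>
  have "(\<integral>\<^sup>+ \<omega>. ennreal (\<bar>?T \<omega>\<bar> powr r) \<partial>M) < \<infinity>"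
    if c: "c > r / (real n - 1)" "?q \<in> O[at_right 0](\<lambda>h. h powr c)" for c
  proof -
    obtain C where C: "C > 0" "eventually (\<lambda>h. norm (?q h) \<le> C * norm (h powr c)) (at_right 0)"
      using c(2) by (elim landau_o.bigE)
    then obtain b where b: "b > 0" "\<And>h. 0 < h \<Longrightarrow> h < b \<Longrightarrow> ?q h \<le> C * h powr c"
      by (auto simp: eventually_at_right_field abs_le_iff)
    \<comment> \<open>Raising \<open>h powr c\<close> to the power \<open>n - 1\<close> gives tail
      exponent \<open>s\<close>; the hypothesis on \<open>c\<close> says exactly that
      \<open>s > r\<close>.\<close>
    define s where "s = c * real (n - 1)"
    have s: "r < s" using c(1) n by (simp add: s_def of_nat_diff field_simps)
    show ?thesis
    proof (rule nn_integral_powr_finite_if_tail[OF assms(3) _ r s])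
      \<comment> \<open>The first threshold is the one in \<open>rel_close_if_t_stat_large\<close>;
        the second makes \<open>h = 4n/t\<close> at most \<open>b/2\<close>, hence strictly below
        \<open>b\<close>.\<close>
      fix t assume t: "t \<ge> max (4 * real n) (8 * real n / b)"
      define h where "h = 4 * real n / t"
      have t0: "t > 0" "t \<ge> 4 * real n" using t n by auto
      have h: "0 < h" "h < b" using t t0 n b(1) by (auto simp: h_def field_simps)
      have "\<bar>Xs i \<omega> - Xs 1 \<omega>\<bar> \<le> \<bar>Xs 1 \<omega>\<bar> * h" if "\<bar>?T \<omega>\<bar> > t" "i \<in> {2..n}" for i \<omega>
        using rel_close_if_t_stat_large[OF n t0(2) that(1), of i] that(2) by (simp add: h_def)
      then have "prob {\<omega> \<in> space M. \<bar>?T \<omega>\<bar> > t}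
          \<le> prob {\<omega> \<in> space M. \<forall>i\<in>{2..n}. \<bar>Xs i \<omega> - Xs 1 \<omega>\<bar> \<le> \<bar>Xs 1 \<omega>\<bar> * h}"
        by (intro finite_measure_mono closeM) blast
      also have "\<dots> \<le> ?q h ^ (n - 1)" by (rule close)
      also have "\<dots> \<le> (C * h powr c) ^ (n - 1)"
        using b(2)[OF h] q0 by (intro power_mono)
      also have "\<dots> = C ^ (n - 1) * h powr s"
        using h by (simp add: power_mult_distrib s_def powr_powr[symmetric] powr_realpow)
      also have "h powr s = (4 * real n) powr s * t powr (- s)"
        using t0 n by (simp add: h_def powr_divide powr_minus_divide)
      finally show "prob {\<omega> \<in> space M. \<bar>?T \<omega>\<bar> > t}
          \<le> (C ^ (n - 1) * (4 * real n) powr s) * t powr (- s)" by simp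
    qed measurable
  qed

  \<comment> \<open>Concentration bound from the finite moment\<close>
  moreover have "?q \<in> O[at_right 0](\<lambda>h. h powr (r / real n))"
    if fin: "(\<integral>\<^sup>+ \<omega>. ennreal (\<bar>?T \<omega>\<bar> powr r) \<partial>M) < \<infinity>"
  proof -
    obtain I where I: "I \<ge> 0" "(\<integral>\<^sup>+ \<omega>. ennreal (\<bar>?T \<omega>\<bar> powr r) \<partial>M) = ennreal I"
      using fin by (cases "\<integral>\<^sup>+ \<omega>. ennreal (\<bar>?T \<omega>\<bar> powr r) \<partial>M") auto
    have bound: "?q h \<le> (2 powr r * I) powr (1 / real n) * h powr (r / real n)"
      if h: "0 < h" "h \<le> 1/2" for h
      unfolding rel_conc_def
    proof (rule cSUP_least)
      fix x
      \<comment> \<open>This is the event \<open>|T| \<ge> 1 / (2 * h)\<close>, put in the form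
        required by Markov's inequality.\<close>
      have B: "{\<omega> \<in> space M. 1 \<le> ennreal ((2 * h) powr r) * ennreal (\<bar>?T \<omega>\<bar> powr r)} \<in> events"
        by measurable
      show "?p x h \<le> (2 powr r * I) powr (1 / real n) * h powr (r / real n)"
      \<comment> \<open>At \<open>x = 0\<close> the window shrinks to the point 0, which is no atom;
        a relative distance is informative only for other centres.\<close>
      proof (cases "x = 0")
        case True
        then show ?thesis using pX0[of 0] by simp
      next
        case False
        \<comment> \<open>The inclusion is claimed only almost everywhere: on constant samples
          \<open>t_stat\<close> is 0, but these form a null set by \<open>sd\<close>.\<close>
        have AE: "AE \<omega> in M. \<omega> \<in> {\<omega> \<in> space M. \<forall>i\<in>{1..n}. \<bar>Xs i \<omega> - x\<bar> \<le> \<bar>x\<bar> * h}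
            \<longrightarrow> \<omega> \<in> {\<omega> \<in> space M. 1 \<le> ennreal ((2 * h) powr r) * ennreal (\<bar>?T \<omega>\<bar> powr r)}"
          using sd
        proof (rule AE_mp, intro AE_I2 impI)
          fix \<omega> assume sd: "sample_sd n (\<lambda>i. Xs i \<omega>) > 0"
            and \<omega>: "\<omega> \<in> {\<omega> \<in> space M. \<forall>i\<in>{1..n}. \<bar>Xs i \<omega> - x\<bar> \<le> \<bar>x\<bar> * h}"
          have "1 / (2 * h) \<le> \<bar>?T \<omega>\<bar>"
            using \<omega> by (intro t_stat_large_if_rel_close[OF n h False _ sd]) auto
          then have "1 \<le> 2 * h * \<bar>?T \<omega>\<bar>" using h by (simp add: field_simps)
          then have "1 \<le> (2 * h * \<bar>?T \<omega>\<bar>) powr r" using r by (intro ge_one_powr_ge_zero) auto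
          also have "\<dots> = (2 * h) powr r * \<bar>?T \<omega>\<bar> powr r" using h by (intro powr_mult)
          finally show "\<omega> \<in> {\<omega> \<in> space M. 1 \<le> ennreal ((2 * h) powr r) * ennreal (\<bar>?T \<omega>\<bar> powr r)}"
            using \<omega> by (simp add: ennreal_mult'[symmetric])
        qed
        have "ennreal (?p x h ^ n) = emeasure M {\<omega> \<in> space M. \<forall>i\<in>{1..n}. \<bar>Xs i \<omega> - x\<bar> \<le> \<bar>x\<bar> * h}"
          using prob_all_close_eq[OF assms(3,4,5,6,7), of n x h] n
          by (simp add: emeasure_eq_measure)
        also have "\<dots> \<le> emeasure M {\<omega> \<in> space M. 1 \<le> ennreal ((2 * h) powr r) * ennreal (\<bar>?T \<omega>\<bar> powr r)}"
          using AE B by (rule emeasure_mono_AE)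
        also have "\<dots> \<le> ennreal ((2 * h) powr r) * (\<integral>\<^sup>+ \<omega>. ennreal (\<bar>?T \<omega>\<bar> powr r) * indicator (space M) \<omega> \<partial>M)"
          by (rule nn_integral_Markov_inequality) auto
        also have "\<dots> = ennreal ((2 * h) powr r) * (\<integral>\<^sup>+ \<omega>. ennreal (\<bar>?T \<omega>\<bar> powr r) \<partial>M)"
          by (intro arg_cong2[where f = "(*)"] refl nn_integral_cong) auto
        also have "\<dots> = ennreal ((2 * h) powr r * I)"
          using I(1) by (simp add: I(2) ennreal_mult)
        finally have le: "?p x h ^ n \<le> (2 * h) powr r * I"
          using I(1) by (simp add: ennreal_le_iff)
        \<comment> \<open>Taking \<open>n\<close>-th roots turns the exponent \<open>r\<close> into
          \<open>r / n\<close>. The case of probability 0 is separate because rewriting the power as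
          \<open>powr\<close> needs a positive base.\<close>
        have "?p x h = (?p x h ^ n) powr (1 / real n)"
          using n by (cases "?p x h = 0")
            (auto simp: powr_realpow[symmetric] powr_powr zero_power less_le)
        also have "\<dots> \<le> ((2 * h) powr r * I) powr (1 / real n)"
          using le by (intro powr_mono2) auto
        also have "\<dots> = (2 powr r * I * h powr r) powr (1 / real n)"
          using h by (simp add: powr_mult mult_ac)
        also have "\<dots> = (2 powr r * I) powr (1 / real n) * h powr (r / real n)"
          using I(1) by (simp add: powr_mult powr_powr)
        finally show ?thesis .
      qed
    qed simp
    show ?thesis
    proof (rule bigoI)
      have "eventually (\<lambda>h::real. 0 < h \<and> h \<le> 1/2) (at_right 0)"
        by (auto simp: eventually_at_right_field intro!: exI[of _ "1/2"])
      then show "eventually (\<lambda>h. norm (?q h)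
          \<le> (2 powr r * I) powr (1 / real n) * norm (h powr (r / real n))) (at_right 0)"
        by eventually_elim (use bound q0 in auto)
    qed
  qed
  ultimately show ?thesis by blast
qed

end
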